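(* Let $\mathcal E:=\mathbb C\setminus\{(-\infty,-1]\cup[1,+\infty)\}$, let $\mathfrak M,H,\mathcal K$ be Hilbert spaces and let $$\mathbf S=\begin{bmatrix} A & B \\ B^* & G \end{bmatrix}:H\oplus\mathcal K\to H\oplus\mathcal K,\qquad \mathbf K=\begin{bmatrix} K_{11} & K_{12} \\ K_{12}^* & K_{22} \end{bmatrix}:\mathfrak M\oplus H\to\mathfrak M\oplus H$$ be selfadjoint contractions. Let $\sigma=\{\mathbf S;H,H,\mathcal K\}$ be the corresponding passive selfadjoint system with transfer function $\Omega(z)$, and let $$\Theta(z)=K_{11}+K_{12}\Omega(z)(I-K_{22}\Omega(z))^{-1}K_{12}^*,\qquad z\in\mathcal E .$$ 1) Assume that $\|K_{22}\|<1$. Then $\Theta(z)$ is the transfer function of the passive selfadjoint system $\tau=\{\mathbf T;\mathfrak M,\mathfrak M,\mathcal K\}$, where $\mathbf T=\mathbf K\bullet\mathbf S$ is the Redheffer product $$\mathbf T=\begin{bmatrix} K_{11}+K_{12}A(I-K_{22}A)^{-1}K_{12}^* & K_{12}(I-AK_{22})^{-1}B \\ B^*(I-K_{22}A)^{-1}K_{12}^* & G+B^*K_{22}(I-AK_{22})^{-1}B \end{bmatrix}:\mathfrak M\oplus\mathcal K\to\mathfrak M\oplus\mathcal K .$$ 2) Assume that $A=0$. Then the Redheffer product $\mathbf T=\mathbf K\bullet\mathbf S$ is given by $$\mathbf T=\begin{bmatrix} K_{11} & K_{12}B \\ B^*K_{12}^* & G+B^*K_{22}B \end{bmatrix}:\mathfrak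 M\oplus\mathcal K\to\mathfrak M\oplus\mathcal K,$$ and the transfer function of the passive selfadjoint system $\tau=\{\mathbf T;\mathfrak M,\mathfrak M,\mathcal K\}$ is equal to the function $\Theta$.
   Context: Hilbert spaces are complex and separable. A passive selfadjoint system $\{T;\mathfrak M,\mathfrak M,\mathcal K\}$ is given by a selfadjoint contraction $T=\begin{bmatrix} D & C \\ C^* & F \end{bmatrix}$ in $\mathfrak M\oplus\mathcal K$ (input-output space $\mathfrak M$, state space $\mathcal K$); its transfer function is $D+zC(I-zF)^{-1}C^*$, $z\in\mathcal E$. In particular the transfer function of $\sigma$ is $\Omega(z)=A+zB(I-zG)^{-1}B^*$. The claims include that $\mathbf T$ is a selfadjoint contraction. The Redheffer product $\mathbf K\bullet\mathbf S$ is the block operator displayed in part 1), whenever the inverses in it exist as bounded operators. *)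

theory Defs
  imports "HOL-Analysis.Analysis"
begin

section \<open>Complex separable Hilbert spaces\<close>

class complex_vector = real_vector +
  fixes scaleC :: "complex \<Rightarrow> 'a \<Rightarrow> 'a" (infixr "*\<^sub>C" 75)
  assumes scaleC_add_right: "c *\<^sub>C (x + y) = c *\<^sub>C x + c *\<^sub>C y"
    and scaleC_add_left: "(c + d) *\<^sub>C x = c *\<^sub>C x + d *\<^sub>C x"
    and scaleC_scaleC: "c *\<^sub>C (d *\<^sub>C x) = (c * d) *\<^sub>C x"
    and scaleC_of_real: "of_real r *\<^sub>C x = r *\<^sub>R x"

text \<open>The inner product is linear in its first argument.  Its real part is the inner product
  of \<^class>\<open>real_inner\<close>, so that both inner products induce the same norm.\<close>

class complex_inner = complex_vector + real_inner +
  fixes cinner :: "'a \<Rightarrow> 'a \<Rightarrow> complex"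
  assumes cinner_commute: "cinner x y = cnj (cinner y x)"
    and cinner_add_left: "cinner (x + y) z = cinner x z + cinner y z"
    and cinner_scaleC_left: "cinner (c *\<^sub>C x) y = c * cinner x y"
    and Re_cinner: "Re (cinner x y) = inner x y"

text \<open>A metric space has a countable base if and only if it is separable.\<close>

class chilbert_space = complex_inner + complete_space + second_countable_topology

lemma scaleC_one [simp]: "1 *\<^sub>C (x::'a::complex_vector) = x"
  using scaleC_of_real[of 1 x] by simp

lemma scaleC_zero_right [simp]: "c *\<^sub>C (0::'a::complex_vector) = 0"
  using scaleC_add_right[of c 0 "0::'a"] by simp

lemma scaleC_minus_right: "c *\<^sub>C (- x::'a::complex_vector) = - (c *\<^sub>C x)"
  using scaleC_add_right[of c x "- x"] by (simp add: eq_neg_iff_add_eq_0 add.commute)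

lemma scaleC_diff_right: "c *\<^sub>C (x - y::'a::complex_vector) = c *\<^sub>C x - c *\<^sub>C y"
  using scaleC_add_right[of c x "- y"] by (simp add: scaleC_minus_right)

lemma scaleC_scaleR: "c *\<^sub>C (r *\<^sub>R x) = r *\<^sub>R (c *\<^sub>C (x::'a::complex_vector))"
  by (simp add: scaleC_of_real[symmetric] scaleC_scaleC mult.commute)

lemma cinner_add_right:
  fixes x :: "'a::complex_inner"
  shows "cinner x (y + z) = cinner x y + cinner x z"
  by (metis cinner_add_left cinner_commute complex_cnj_add)

lemma cinner_scaleC_right:
  fixes x :: "'a::complex_inner"
  shows "cinner x (c *\<^sub>C y) = cnj c * cinner x y"
  by (metis cinner_scaleC_left cinner_commute complex_cnj_mult)

lemma Im_cinner:
  fixes x :: "'a::complex_inner"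
  shows "Im (cinner x y) = - inner (\<i> *\<^sub>C x) y"
  by (simp add: Re_cinner[symmetric] cinner_scaleC_left)

lemma norm_scaleC: "norm (c *\<^sub>C x) = cmod c * norm (x::'a::complex_inner)"
proof -
  have "cinner (c *\<^sub>C x) (c *\<^sub>C x) = of_real ((cmod c)\<^sup>2) * cinner x x"
    by (simp add: cinner_scaleC_left cinner_scaleC_right complex_norm_square mult.assoc[symmetric]
        del: of_real_power)
  then have "inner (c *\<^sub>C x) (c *\<^sub>C x) = (cmod c)\<^sup>2 * inner x x"
    by (simp add: Re_cinner[symmetric] del: of_real_power)
  then show ?thesis
    by (simp add: norm_eq_sqrt_inner real_sqrt_mult)
qed

instantiation complex :: chilbert_space
begin

definition scaleC_complex :: "complex \<Rightarrow> complex \<Rightarrow> complex"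
  where "scaleC_complex c x = c * x"

definition cinner_complex :: "complex \<Rightarrow> complex \<Rightarrow> complex"
  where "cinner_complex x y = x * cnj y"

instance
  by standard (auto simp: scaleC_complex_def cinner_complex_def algebra_simps scaleR_conv_of_real
      inner_complex_def)

end

text \<open>The product type carries the orthogonal direct sum.\<close>

instantiation prod :: (complex_vector, complex_vector) complex_vector
begin

definition scaleC_prod :: "complex \<Rightarrow> 'a \<times> 'b \<Rightarrow> 'a \<times> 'b"
  where "scaleC_prod c p = (c *\<^sub>C fst p, c *\<^sub>C snd p)"

instance
  by standard (auto simp: scaleC_prod_def scaleC_add_right scaleC_add_left scaleC_scaleC
      scaleC_of_real scaleR_prod_def)

end

instantiation prod :: (complex_inner, complex_inner) complex_inner
begin

definition cinner_prod :: "'a \<times> 'b \<Rightarrow> 'a \<times> 'b \<Rightarrow> complex"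
  where "cinner_prod p q = cinner (fst p) (fst q) + cinner (snd p) (snd q)"

instance
  by standard (auto simp: cinner_prod_def scaleC_prod_def cinner_add_left cinner_scaleC_left
      Re_cinner inner_prod_def algebra_simps intro: cinner_commute simp flip: cinner_commute)

end

instance prod :: (chilbert_space, chilbert_space) chilbert_space ..

lemma scaleC_Pair [simp]: "c *\<^sub>C (x, y) = (c *\<^sub>C x, c *\<^sub>C y)"
  by (simp add: scaleC_prod_def)

lemma cinner_Pair [simp]: "cinner (x, y) (u, v) = cinner x u + cinner y v"
  by (simp add: cinner_prod_def)


section \<open>Bounded complex-linear operators\<close>

definition bounded_clinear :: "('a::complex_inner \<Rightarrow> 'b::complex_inner) \<Rightarrow> bool"
  where "bounded_clinear f \<longleftrightarrow> bounded_linear f \<and> (\<forall>c x. f (c *\<^sub>C x) = c *\<^sub>C f x)"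

text \<open>The arrow binds weaker than \<open>\<times>\<close>.\<close>

typedef (overloaded) ('a, 'b) cop ("(_ \<Rightarrow>\<^sub>H /_)" [16, 15] 15) =
  "{f :: 'a::complex_inner \<Rightarrow> 'b::complex_inner. bounded_clinear f}"
  morphisms cop_apply Cop
  by (rule exI[of _ "\<lambda>_. 0"]) (simp add: bounded_clinear_def)

setup_lifting type_definition_cop

lemma cop_eqI: "(\<And>x. cop_apply S x = cop_apply T x) \<Longrightarrow> S = T"
  by transfer auto

lemma bounded_linear_cop: "bounded_linear (cop_apply T)"
  by transfer (simp add: bounded_clinear_def)

lemma cop_scaleC: "cop_apply T (c *\<^sub>C x) = c *\<^sub>C cop_apply T x"
  by transfer (simp add: bounded_clinear_def)

lemma bounded_clinear_scaleC:
  assumes "bounded_clinear f"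
  shows "bounded_clinear (\<lambda>x. c *\<^sub>C f x)"
proof -
  interpret f: bounded_linear f
    using assms by (simp add: bounded_clinear_def)
  obtain K where K: "\<And>x. norm (f x) \<le> norm x * K"
    using f.bounded by blast
  have "bounded_linear (\<lambda>x. c *\<^sub>C f x)"
  proof (rule bounded_linear_intro[where K = "cmod c * K"])
    show "norm (c *\<^sub>C f x) \<le> norm x * (cmod c * K)" for x
      using mult_left_mono[OF K[of x], of "cmod c"] by (simp add: norm_scaleC mult_ac)
  qed (simp_all add: f.add f.scaleR scaleC_add_right scaleC_scaleR)
  then show ?thesis
    using assms by (simp add: bounded_clinear_def scaleC_scaleC mult.commute)
qed

instantiation cop :: (complex_inner, complex_inner) real_normed_vector
begin

lift_definition norm_cop :: "('a \<Rightarrow>\<^sub>H 'b) \<Rightarrow> real" is onorm .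

lift_definition minus_cop :: "('a \<Rightarrow>\<^sub>H 'b) \<Rightarrow> ('a \<Rightarrow>\<^sub>H 'b) \<Rightarrow> ('a \<Rightarrow>\<^sub>H 'b)"
  is "\<lambda>f g x. f x - g x"
  by (simp add: bounded_clinear_def bounded_linear_sub scaleC_diff_right)

definition dist_cop :: "('a \<Rightarrow>\<^sub>H 'b) \<Rightarrow> ('a \<Rightarrow>\<^sub>H 'b) \<Rightarrow> real"
  where "dist_cop S T = norm (S - T)"

definition
  "(uniformity :: (('a \<Rightarrow>\<^sub>H 'b) \<times> ('a \<Rightarrow>\<^sub>H 'b)) filter) = (INF e\<in>{0 <..}. principal {(x, y). dist x y < e})"

definition open_cop :: "('a \<Rightarrow>\<^sub>H 'b) set \<Rightarrow> bool"
  where "open_cop U = (\<forall>x\<in>U. \<forall>\<^sub>F (x', y) in uniformity. x' = x \<longrightarrow> y \<in> U)"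

lift_definition uminus_cop :: "('a \<Rightarrow>\<^sub>H 'b) \<Rightarrow> ('a \<Rightarrow>\<^sub>H 'b)" is "\<lambda>f x. - f x"
  by (simp add: bounded_clinear_def bounded_linear_minus scaleC_minus_right)

lift_definition zero_cop :: "'a \<Rightarrow>\<^sub>H 'b" is "\<lambda>x. 0"
  by (simp add: bounded_clinear_def)

lift_definition plus_cop :: "('a \<Rightarrow>\<^sub>H 'b) \<Rightarrow> ('a \<Rightarrow>\<^sub>H 'b) \<Rightarrow> ('a \<Rightarrow>\<^sub>H 'b)"
  is "\<lambda>f g x. f x + g x"
  by (simp add: bounded_clinear_def bounded_linear_add scaleC_add_right)

lift_definition scaleR_cop :: "real \<Rightarrow> ('a \<Rightarrow>\<^sub>H 'b) \<Rightarrow> ('a \<Rightarrow>\<^sub>H 'b)"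
  is "\<lambda>r f x. r *\<^sub>R f x"
  by (simp add: bounded_clinear_def bounded_linear_const_scaleR scaleC_scaleR)

definition sgn_cop :: "('a \<Rightarrow>\<^sub>H 'b) \<Rightarrow> ('a \<Rightarrow>\<^sub>H 'b)"
  where "sgn_cop T = inverse (norm T) *\<^sub>R T"

instance
  apply standard
  unfolding dist_cop_def open_cop_def sgn_cop_def uniformity_cop_def
  apply (rule refl | (transfer, force simp: bounded_clinear_def onorm_triangle onorm_scaleR
      onorm_eq_0 algebra_simps))+
  done

end

instantiation cop :: (complex_inner, complex_inner) complex_vector
begin

lift_definition scaleC_cop :: "complex \<Rightarrow> ('a \<Rightarrow>\<^sub>H 'b) \<Rightarrow> ('a \<Rightarrow>\<^sub>H 'b)"
  is "\<lambda>c f x. c *\<^sub>C f x"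
  by (rule bounded_clinear_scaleC)

instance
  by standard (transfer, simp add: scaleC_add_right scaleC_add_left scaleC_scaleC
      scaleC_of_real)+

end

lift_definition cop_id :: "'a::complex_inner \<Rightarrow>\<^sub>H 'a" is "\<lambda>x. x"
  by (simp add: bounded_clinear_def)

lift_definition cop_comp ::
  "('b::complex_inner \<Rightarrow>\<^sub>H 'c::complex_inner) \<Rightarrow> ('a::complex_inner \<Rightarrow>\<^sub>H 'b) \<Rightarrow> ('a \<Rightarrow>\<^sub>H 'c)"
  (infixl "o\<^sub>C" 70) is "\<lambda>g f x. g (f x)"
  by (simp add: bounded_clinear_def bounded_linear_compose)

definition cop_inverse_of :: "('b::complex_inner \<Rightarrow>\<^sub>H 'a) \<Rightarrow> ('a::complex_inner \<Rightarrow>\<^sub>H 'b) \<Rightarrow> bool"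
  where "cop_inverse_of R T \<longleftrightarrow> R o\<^sub>C T = cop_id \<and> T o\<^sub>C R = cop_id"

definition cop_invertible :: "('a::complex_inner \<Rightarrow>\<^sub>H 'b::complex_inner) \<Rightarrow> bool"
  where "cop_invertible T \<longleftrightarrow> (\<exists>R. cop_inverse_of R T)"

text \<open>Meaningful only under \<^const>\<open>cop_invertible\<close>.\<close>

definition cop_inv :: "('a::complex_inner \<Rightarrow>\<^sub>H 'b::complex_inner) \<Rightarrow> ('b \<Rightarrow>\<^sub>H 'a)"
  where "cop_inv T = (THE R. cop_inverse_of R T)"

lemma cop_comp_assoc: "R o\<^sub>C S o\<^sub>C T = R o\<^sub>C (S o\<^sub>C T)"
  by transfer simp

lemma cop_comp_id [simp]: "T o\<^sub>C cop_id = T" "cop_id o\<^sub>C T = T"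
  by (transfer, simp)+

lemma cop_inverse_of_unique:
  assumes "cop_inverse_of R T" "cop_inverse_of R' T"
  shows "R = R'"
  using assms unfolding cop_inverse_of_def by (metis cop_comp_assoc cop_comp_id)

lemma cop_inv_eqI: "cop_inverse_of R T \<Longrightarrow> cop_inv T = R"
  unfolding cop_inv_def by (blast intro: cop_inverse_of_unique)

lemma cop_inverse_of_cop_inv: "cop_invertible T \<Longrightarrow> cop_inverse_of (cop_inv T) T"
  unfolding cop_invertible_def using cop_inv_eqI by blast


section \<open>Adjoints\<close>

definition cop_adj :: "('a::chilbert_space \<Rightarrow>\<^sub>H 'b::chilbert_space) \<Rightarrow> ('b \<Rightarrow>\<^sub>H 'a)"
    ("(_\<^sup>\<star>)" [1000] 999)
  where "T\<^sup>\<star> = (THE R. \<forall>x y. cinner (cop_apply T x) y = cinner x (cop_apply R y))"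

text \<open>That the description above denotes follows from the Riesz representation theorem, obtained
  here by minimising \<open>x \<mapsto> \<parallel>x\<parallel>\<^sup>2 - 2 f x\<close>.\<close>

lemma riesz_representation:
  fixes f :: "'a::{real_inner, complete_space} \<Rightarrow> real"
  assumes "bounded_linear f"
  shows "\<exists>y. \<forall>x. f x = inner x y"
proof -
  interpret f: bounded_linear f by fact
  define q where "q x = (norm x)\<^sup>2 - 2 * f x" for x
  obtain C where C: "\<And>x. \<bar>f x\<bar> \<le> norm x * C"
    using f.bounded by auto
  have q_lower: "- C\<^sup>2 \<le> q x" for x
  proof -
    have "0 \<le> (norm x - C)\<^sup>2" by simp
    then show ?thesis
      using C[of x] unfolding q_def power2_diff by linarith
  qed
  define m where "m = (INF x. q x)"
  have bdd: "bdd_below (range q)"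
    using q_lower by (meson bdd_belowI2)
  have m_le: "m \<le> q x" for x
    unfolding m_def by (rule cINF_lower[OF bdd]) simp
  have par: "(norm (x - y))\<^sup>2 = 2 * (q x + q y - 2 * q ((1/2) *\<^sub>R (x + y)))" for x y
    unfolding q_def by (simp add: f.add f.scaleR power2_norm_eq_inner inner_commute algebra_simps)
  have "\<exists>x. q x < m + inverse (real (Suc n))" for n
    using cINF_less_iff[OF _ bdd, of "m + inverse (real (Suc n))"] by (auto simp: m_def)
  then obtain X where X: "\<And>n. q (X n) < m + inverse (real (Suc n))"
    by metis
  have "Cauchy X"
  proof (rule metric_CauchyI)
    fix e :: real
    assume "e > 0"
    then obtain N where N: "inverse (real (Suc N)) < e\<^sup>2 / 4"
      using reals_Archimedean[of "e\<^sup>2 / 4"] by auto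
    have "dist (X i) (X j) < e" if "i \<ge> N" "j \<ge> N" for i j
    proof -
      have "q (X k) < m + e\<^sup>2 / 4" if "k \<ge> N" for k
      proof -
        have "inverse (real (Suc k)) \<le> inverse (real (Suc N))"
          using that by (intro le_imp_inverse_le) auto
        then show ?thesis using X[of k] N by linarith
      qed
      from this[OF that(1)] this[OF that(2)] have "(norm (X i - X j))\<^sup>2 < e\<^sup>2"
        using m_le[of "(1/2) *\<^sub>R (X i + X j)"] unfolding par by (simp add: field_simps)
      then show ?thesis
        using \<open>e > 0\<close> by (simp add: dist_norm power_less_imp_less_base)
    qed
    then show "\<exists>M. \<forall>i\<ge>M. \<forall>j\<ge>M. dist (X i) (X j) < e" by blast
  qed
  then obtain y where y: "X \<longlonglongrightarrow> y"
    using Cauchy_convergent_iff convergent_def by blast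
  have "(\<lambda>n. q (X n)) \<longlonglongrightarrow> q y"
    unfolding q_def by (intro tendsto_intros f.tendsto y)
  moreover have "(\<lambda>n. m + inverse (real (Suc n))) \<longlonglongrightarrow> m"
    using tendsto_add[OF tendsto_const[of m] LIMSEQ_inverse_real_of_nat] by simp
  ultimately have "q y \<le> m"
    by (rule LIMSEQ_le) (use X less_imp_le in blast)
  then have y_min: "q y \<le> q x" for x
    using m_le[of x] by linarith
  have "f x = inner x y" for x
  proof (rule ccontr)
    assume "f x \<noteq> inner x y"
    define d where "d = f x - inner x y"
    define s where "s = (norm x)\<^sup>2 + 1"
    have "d \<noteq> 0" using \<open>f x \<noteq> inner x y\<close> by (simp add: d_def)
    have "s > 0" by (simp add: s_def add_nonneg_pos)
    have "q (y + t *\<^sub>R x) = q y - 2 * t * d + t\<^sup>2 * (norm x)\<^sup>2" for t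
      unfolding q_def d_def power2_norm_eq_inner
      by (simp add: f.add f.scaleR inner_commute algebra_simps power2_eq_square)
    from this[of "d / s"]
    have "q (y + (d / s) *\<^sub>R x) = q y - 2 * (d / s) * d + (d / s)\<^sup>2 * (norm x)\<^sup>2" .
    then have "2 * (d / s) * d \<le> (d / s)\<^sup>2 * (norm x)\<^sup>2"
      using y_min[of "y + (d / s) *\<^sub>R x"] by linarith
    also have "\<dots> \<le> (d / s)\<^sup>2 * s"
      by (intro mult_left_mono) (auto simp: s_def)
    also have "\<dots> = (d / s) * d"
      using \<open>s > 0\<close> by (simp add: power2_eq_square)
    finally have "d * d / s \<le> 0" by simp
    moreover have "d * d / s > 0"
      using \<open>d \<noteq> 0\<close> \<open>s > 0\<close> by (intro divide_pos_pos) (auto simp: zero_less_mult_iff)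
    ultimately show False by simp
  qed
  then show ?thesis by blast
qed

lemma cinner_eq_imp_eq:
  fixes u v :: "'a::complex_inner"
  assumes "\<And>x. cinner x u = cinner x v"
  shows "u = v"
proof -
  have "inner x u = inner x v" for x
    using assms[of x] by (metis Re_cinner)
  then have "inner (u - v) (u - v) = 0"
    by (simp add: inner_diff_right)
  then show ?thesis by simp
qed

lemma cop_adj_exists:
  fixes T :: "'a::chilbert_space \<Rightarrow>\<^sub>H 'b::chilbert_space"
  shows "\<exists>R. \<forall>x y. cinner (cop_apply T x) y = cinner x (cop_apply R y)"
proof -
  interpret T: bounded_linear "cop_apply T" by (rule bounded_linear_cop)
  have "\<exists>z. \<forall>x. inner (cop_apply T x) y = inner x z" for y
    by (rule riesz_representation) (rule bounded_linear_inner_left_comp[OF bounded_linear_cop])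
  then obtain g where g: "\<And>x y. inner (cop_apply T x) y = inner x (g y)"
    by metis
  have cg: "cinner (cop_apply T x) y = cinner x (g y)" for x y
    by (rule complex_eqI) (simp_all add: Re_cinner Im_cinner g flip: cop_scaleC)
  have add: "g (y + z) = g y + g z" for y z
    by (rule cinner_eq_imp_eq) (simp add: cinner_add_right flip: cg)
  have scale: "g (c *\<^sub>C y) = c *\<^sub>C g y" for c y
    by (rule cinner_eq_imp_eq) (simp add: cinner_scaleC_right flip: cg)
  obtain C where C: "\<And>x. norm (cop_apply T x) \<le> norm x * C" and "C > 0"
    using T.pos_bounded by blast
  have bound: "norm (g y) \<le> norm y * C" for y
  proof (cases "g y = 0")
    case False
    have "norm (g y) * norm (g y) = inner (cop_apply T (g y)) y"
      by (simp add: g power2_norm_eq_inner flip: power2_eq_square)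
    also have "\<dots> \<le> norm (cop_apply T (g y)) * norm y"
      by (rule norm_cauchy_schwarz)
    also have "\<dots> \<le> norm (g y) * C * norm y"
      by (intro mult_right_mono C norm_ge_zero)
    finally show ?thesis
      using False by (simp add: mult_ac)
  qed (use \<open>C > 0\<close> in simp)
  have "bounded_clinear g"
    unfolding bounded_clinear_def
    by (intro conjI allI scale bounded_linear_intro[where K = C] add bound)
      (simp add: scale flip: scaleC_of_real)
  then show ?thesis
    using cg by (intro exI[of _ "Cop g"]) (simp add: Cop_inverse)
qed

lemma cop_adj_eqI:
  assumes "\<And>x y. cinner (cop_apply T x) y = cinner x (cop_apply R y)"
  shows "T\<^sup>\<star> = R"
  unfolding cop_adj_def
proof (rule the_equality)
  show "\<forall>x y. cinner (cop_apply T x) y = cinner x (cop_apply R y)"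
    using assms by blast
next
  fix R'
  assume "\<forall>x y. cinner (cop_apply T x) y = cinner x (cop_apply R' y)"
  then have "cinner x (cop_apply R' y) = cinner x (cop_apply R y)" for x y
    using assms by metis
  then show "R' = R"
    by (blast intro: cop_eqI cinner_eq_imp_eq)
qed

lemma cinner_cop_adj: "cinner (cop_apply T x) y = cinner x (cop_apply (T\<^sup>\<star>) y)"
  using cop_adj_exists[of T] cop_adj_eqI by metis

definition selfadjoint :: "('a::chilbert_space \<Rightarrow>\<^sub>H 'a) \<Rightarrow> bool"
  where "selfadjoint T \<longleftrightarrow> T\<^sup>\<star> = T"

lemma selfadjoint_iff:
  "selfadjoint T \<longleftrightarrow> (\<forall>x y. cinner (cop_apply T x) y = cinner x (cop_apply T y))"
  unfolding selfadjoint_def by (metis cinner_cop_adj cop_adj_eqI)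

definition contraction :: "('a::complex_inner \<Rightarrow>\<^sub>H 'b::complex_inner) \<Rightarrow> bool"
  where "contraction T \<longleftrightarrow> norm T \<le> 1"


section \<open>Block operators\<close>

lemma bounded_clinear_block:
  assumes "bounded_clinear a" "bounded_clinear b" "bounded_clinear c" "bounded_clinear d"
  shows "bounded_clinear (\<lambda>(x, y). (a x + b y, c x + d y))"
proof -
  have "bounded_linear (\<lambda>p. (a (fst p) + b (snd p), c (fst p) + d (snd p)))"
    using assms unfolding bounded_clinear_def
    by (intro bounded_linear_Pair bounded_linear_add)
      (auto intro: bounded_linear_compose bounded_linear_fst bounded_linear_snd)
  then show ?thesis
    using assms by (simp add: bounded_clinear_def case_prod_unfold scaleC_add_right scaleC_prod_def)
qed

text \<open>\<open>block P Q R S\<close> is the operator matrix with rows \<open>P Q\<close> and \<open>R S\<close>.\<close>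

lift_definition block ::
  "('a::complex_inner \<Rightarrow>\<^sub>H 'c::complex_inner) \<Rightarrow> ('b::complex_inner \<Rightarrow>\<^sub>H 'c) \<Rightarrow>
   ('a \<Rightarrow>\<^sub>H 'd::complex_inner) \<Rightarrow> ('b \<Rightarrow>\<^sub>H 'd) \<Rightarrow> ('a \<times> 'b \<Rightarrow>\<^sub>H 'c \<times> 'd)"
  is "\<lambda>P Q R S (x, y). (P x + Q y, R x + S y)"
  by (rule bounded_clinear_block)

lemma bounded_clinear_compose:
  "bounded_clinear g \<Longrightarrow> bounded_clinear f \<Longrightarrow> bounded_clinear (\<lambda>x. g (f x))"
  by (simp add: bounded_clinear_def bounded_linear_compose)

lemma bounded_clinear_prod:
  "bounded_clinear fst" "bounded_clinear snd"
  "bounded_clinear (\<lambda>x. (x, 0))" "bounded_clinear (\<lambda>y. (0, y))"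
  by (auto simp: bounded_clinear_def scaleC_prod_def bounded_linear_fst bounded_linear_snd
      intro!: bounded_linear_Pair bounded_linear_ident bounded_linear_zero)

lift_definition block11 :: "('a::complex_inner \<times> 'b::complex_inner \<Rightarrow>\<^sub>H 'c::complex_inner \<times> 'd::complex_inner)
    \<Rightarrow> ('a \<Rightarrow>\<^sub>H 'c)"
  is "\<lambda>f x. fst (f (x, 0))"
  by (intro bounded_clinear_compose[OF bounded_clinear_prod(1)]
      bounded_clinear_compose[OF _ bounded_clinear_prod(3)])

lift_definition block12 :: "('a::complex_inner \<times> 'b::complex_inner \<Rightarrow>\<^sub>H 'c::complex_inner \<times> 'd::complex_inner)
    \<Rightarrow> ('b \<Rightarrow>\<^sub>H 'c)"
  is "\<lambda>f y. fst (f (0, y))"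
  by (intro bounded_clinear_compose[OF bounded_clinear_prod(1)]
      bounded_clinear_compose[OF _ bounded_clinear_prod(4)])

lift_definition block21 :: "('a::complex_inner \<times> 'b::complex_inner \<Rightarrow>\<^sub>H 'c::complex_inner \<times> 'd::complex_inner)
    \<Rightarrow> ('a \<Rightarrow>\<^sub>H 'd)"
  is "\<lambda>f x. snd (f (x, 0))"
  by (intro bounded_clinear_compose[OF bounded_clinear_prod(2)]
      bounded_clinear_compose[OF _ bounded_clinear_prod(3)])

lift_definition block22 :: "('a::complex_inner \<times> 'b::complex_inner \<Rightarrow>\<^sub>H 'c::complex_inner \<times> 'd::complex_inner)
    \<Rightarrow> ('b \<Rightarrow>\<^sub>H 'd)"
  is "\<lambda>f y. snd (f (0, y))"
  by (intro bounded_clinear_compose[OF bounded_clinear_prod(2)]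
      bounded_clinear_compose[OF _ bounded_clinear_prod(4)])

lemma cop_apply_zero [simp]: "cop_apply T 0 = 0"
  using linear_0[OF bounded_linear.linear[OF bounded_linear_cop]] .

lemma block_apply: "cop_apply (block P Q R S) (x, y) =
    (cop_apply P x + cop_apply Q y, cop_apply R x + cop_apply S y)"
  by (simp add: block.rep_eq)

lemmas block_entry_apply = block11.rep_eq block12.rep_eq block21.rep_eq block22.rep_eq

lemma block_entries [simp]:
  "block11 (block P Q R S) = P" "block12 (block P Q R S) = Q"
  "block21 (block P Q R S) = R" "block22 (block P Q R S) = S"
  by (rule cop_eqI, simp add: block_entry_apply block_apply)+

lemma block_collapse:
  fixes T :: "'a::complex_inner \<times> 'b::complex_inner \<Rightarrow>\<^sub>H 'c::complex_inner \<times> 'd::complex_inner"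
  shows "block (block11 T) (block12 T) (block21 T) (block22 T) = T"
proof (rule cop_eqI)
  fix p :: "'a \<times> 'b"
  obtain x y where p: "p = (x, y)" by (cases p)
  have "cop_apply T (x, y) = cop_apply T (x, 0) + cop_apply T (0, y)"
    by (simp flip: linear_add[OF bounded_linear.linear[OF bounded_linear_cop]])
  then show "cop_apply (block (block11 T) (block12 T) (block21 T) (block22 T)) p = cop_apply T p"
    by (simp add: p block_entry_apply block_apply prod_eq_iff)
qed


section \<open>Passive selfadjoint systems and the Redheffer product\<close>

definition slit_plane :: "complex set"
  where "slit_plane = UNIV - of_real ` ({..-1} \<union> {1..})"

text \<open>A system \<open>{T; M, M, K}\<close> is represented by its operator \<open>T = (D, C; C\<^sup>\<star>, F)\<close>: the input-output
  space and the state space are the two factors of the type of \<open>T\<close>.\<close>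

definition passive_selfadjoint_system ::
  "('m::chilbert_space \<times> 'k::chilbert_space \<Rightarrow>\<^sub>H 'm \<times> 'k) \<Rightarrow> bool"
  where "passive_selfadjoint_system T \<longleftrightarrow> selfadjoint T \<and> contraction T"

definition transfer_function ::
  "('m::chilbert_space \<times> 'k::chilbert_space \<Rightarrow>\<^sub>H 'm \<times> 'k) \<Rightarrow> complex \<Rightarrow> 'm \<Rightarrow>\<^sub>H 'm"
  where "transfer_function T z =
    (let D = block11 T; C = block12 T; F = block22 T
     in D + z *\<^sub>C (C o\<^sub>C cop_inv (cop_id - z *\<^sub>C F) o\<^sub>C C\<^sup>\<star>))"

definition transfer_defined ::
  "('m::chilbert_space \<times> 'k::chilbert_space \<Rightarrow>\<^sub>H 'm \<times> 'k) \<Rightarrow> complex \<Rightarrow> bool"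
  where "transfer_defined T z \<longleftrightarrow> cop_invertible (cop_id - z *\<^sub>C block22 T)"

lemma transfer_function_block:
  "transfer_function (block D C (C\<^sup>\<star>) F) z =
    D + z *\<^sub>C (C o\<^sub>C cop_inv (cop_id - z *\<^sub>C F) o\<^sub>C C\<^sup>\<star>)"
  by (simp add: transfer_function_def)

text \<open>The Redheffer product is defined only when the two inverses occurring in it exist as bounded
  operators.\<close>

definition redheffer_defined ::
  "('m::chilbert_space \<times> 'h::chilbert_space \<Rightarrow>\<^sub>H 'm \<times> 'h) \<Rightarrow>
   ('h \<times> 'k::chilbert_space \<Rightarrow>\<^sub>H 'h \<times> 'k) \<Rightarrow> bool"
  where "redheffer_defined K S \<longleftrightarrow>
    cop_invertible (cop_id - block22 K o\<^sub>C block11 S) \<and>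
    cop_invertible (cop_id - block11 S o\<^sub>C block22 K)"

definition redheffer ::
  "('m::chilbert_space \<times> 'h::chilbert_space \<Rightarrow>\<^sub>H 'm \<times> 'h) \<Rightarrow>
   ('h \<times> 'k::chilbert_space \<Rightarrow>\<^sub>H 'h \<times> 'k) \<Rightarrow> ('m \<times> 'k \<Rightarrow>\<^sub>H 'm \<times> 'k)"
  where "redheffer K S =
    (let K11 = block11 K; K12 = block12 K; K22 = block22 K;
         A = block11 S; B = block12 S; G = block22 S
     in block
          (K11 + K12 o\<^sub>C A o\<^sub>C cop_inv (cop_id - K22 o\<^sub>C A) o\<^sub>C K12\<^sup>\<star>)
          (K12 o\<^sub>C cop_inv (cop_id - A o\<^sub>C K22) o\<^sub>C B)
          (B\<^sup>\<star> o\<^sub>C cop_inv (cop_id - K22 o\<^sub>C A) o\<^sub>C K12\<^sup>\<star>)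
          (G + B\<^sup>\<star> o\<^sub>C K22 o\<^sub>C cop_inv (cop_id - A o\<^sub>C K22) o\<^sub>C B))"

end

(* Closing the feedback loop K(m, y) = (m', u), S(u, k) = (y, k') defines T(m, k) = (m', k'); the
   inverse of I - K22 A is what solves for the internal signals u and y.  Adding the contraction
   inequalities (respectively the symmetry relations) of K and S cancels the internal signals, so
   T is a selfadjoint contraction.  The spectrum of a selfadjoint contraction F lies in [-1, 1], so
   I - z F is invertible for z in the slit plane.  The operators I - K22 Omega(z) and I - z F_T are
   the two Schur complements of one block operator on H x K, so one is invertible with the other.
   Feeding k = z x, k' = x into the loop identifies both transfer functions. *)

theory Submission
  imports Defs
begin

section \<open>Coercive operators\<close>

lemmas cop_algebra_apply = cop_comp.rep_eq plus_cop.rep_eq minus_cop.rep_eq scaleC_cop.rep_eq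
  cop_id.rep_eq zero_cop.rep_eq

lemma cop_apply_add: "cop_apply T (x + y) = cop_apply T x + cop_apply T y"
  and cop_apply_diff: "cop_apply T (x - y) = cop_apply T x - cop_apply T y"
  and cop_apply_scaleR: "cop_apply T (r *\<^sub>R x) = r *\<^sub>R cop_apply T x"
  using bounded_linear.linear[OF bounded_linear_cop, of T]
  by (simp_all add: linear_add linear_diff linear_scale)

lemma cop_comp_zero [simp]: "T o\<^sub>C 0 = 0" "0 o\<^sub>C T = 0"
  by (auto intro!: cop_eqI simp: cop_algebra_apply)

lemma norm_cop_apply: "norm (cop_apply T x) \<le> norm T * norm x"
  unfolding norm_cop.rep_eq by (rule onorm[OF bounded_linear_cop])

lemma contraction_apply: "contraction T \<Longrightarrow> norm (cop_apply T x) \<le> norm x"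
  using norm_cop_apply[of T x] mult_right_mono[of "norm T" 1 "norm x"]
  by (simp add: contraction_def)

lemma contractionI: "(\<And>x. norm (cop_apply T x) \<le> norm x) \<Longrightarrow> contraction T"
  unfolding contraction_def norm_cop.rep_eq by (rule onorm_bound) auto

lemma norm_cop_comp_le: "norm (S o\<^sub>C T) \<le> norm S * norm T"
  by (simp add: norm_cop.rep_eq cop_comp.rep_eq onorm_compose[OF bounded_linear_cop bounded_linear_cop,
        unfolded comp_def])

text \<open>Multiplying \<open>x\<close> by the unimodular phase \<open>c\<close> turns the inner
  product into its modulus, a real number, so the real Cauchy-Schwarz inequality applies.\<close>

lemma cmod_cinner_le:
  fixes x y :: "'a::complex_inner"
  shows "cmod (cinner x y) \<le> norm x * norm y"
proof (cases "cinner x y = 0")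
  case False
  define c where "c = cnj (sgn (cinner x y))"
  have "cmod c = 1"
    using False by (simp add: c_def norm_sgn)
  have "c * cinner x y = cmod (cinner x y)"
    using False complex_norm_square[of "cinner x y"]
    by (simp add: c_def sgn_div_norm scaleR_conv_of_real field_simps power2_eq_square)
  then have "cmod (cinner x y) = inner (c *\<^sub>C x) y"
    by (simp add: cinner_scaleC_left flip: Re_cinner)
  also have "\<dots> \<le> norm (c *\<^sub>C x) * norm y"
    by (rule norm_cauchy_schwarz)
  finally show ?thesis
    using \<open>cmod c = 1\<close> by (simp add: norm_scaleC)
qed simp

section \<open>Invertibility from coercivity and lower bounds\<close>

text \<open>A Lax-Milgram argument: P x = y says that x is a fixed point of x - e P x + e y, and
  coercivity makes this map a strict contraction for a suitable e > 0.\<close>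

lemma coercive_imp_surj:
  fixes P :: "'a::chilbert_space \<Rightarrow>\<^sub>H 'a"
  assumes "c > 0" and coercive: "\<And>x. c * (norm x)\<^sup>2 \<le> inner (cop_apply P x) x"
  shows "surj (cop_apply P)"
proof -
  \<comment> \<open>Here \<open>e\<close> minimises the bound 1 - 2 e c + e^2 M^2 for the squared
    contraction factor, and \<open>q\<close> is the minimum. Adding \<open>c\<close> to the norm
    ensures 0 < c \<le> M, hence q \<ge> 0.\<close>
  define M where "M = norm P + c"
  define e where "e = c / M\<^sup>2"
  define q where "q = 1 - c\<^sup>2 / M\<^sup>2"
  have M: "M > 0" "c \<le> M"
    using \<open>c > 0\<close> by (auto simp: M_def add_nonneg_pos)
  then have q: "0 \<le> q" "q < 1" and "e > 0"
    using \<open>c > 0\<close> by (auto simp: q_def e_def)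
  have le: "norm (x - e *\<^sub>R cop_apply P x) \<le> sqrt q * norm x" for x
  proof -
    have "norm (cop_apply P x) \<le> M * norm x"
      using norm_cop_apply[of P x] mult_right_mono[of "norm P" M "norm x"] \<open>c > 0\<close>
      by (simp add: M_def)
    then have "(norm (cop_apply P x))\<^sup>2 \<le> M\<^sup>2 * (norm x)\<^sup>2"
      by (metis norm_ge_zero power_mono power_mult_distrib)
    then have "e\<^sup>2 * (norm (cop_apply P x))\<^sup>2 \<le> e\<^sup>2 * (M\<^sup>2 * (norm x)\<^sup>2)"
      by (intro mult_left_mono) auto
    moreover have "2 * e * (c * (norm x)\<^sup>2) \<le> 2 * e * inner (cop_apply P x) x"
      using \<open>e > 0\<close> by (intro mult_left_mono coercive) auto
    moreover have "(norm (x - e *\<^sub>R cop_apply P x))\<^sup>2 =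
        (norm x)\<^sup>2 - 2 * e * inner (cop_apply P x) x + e\<^sup>2 * (norm (cop_apply P x))\<^sup>2"
      unfolding power2_norm_eq_inner by (simp add: inner_commute algebra_simps power2_eq_square)
    moreover have "(norm x)\<^sup>2 - 2 * e * (c * (norm x)\<^sup>2) + e\<^sup>2 * (M\<^sup>2 * (norm x)\<^sup>2) = q * (norm x)\<^sup>2"
      using M by (simp add: e_def q_def field_simps power2_eq_square)
    ultimately have "(norm (x - e *\<^sub>R cop_apply P x))\<^sup>2 \<le> (sqrt q * norm x)\<^sup>2"
      using q by (simp add: power_mult_distrib)
    then show ?thesis
      by (rule power2_le_imp_le) (use q in simp)
  qed
  have "\<exists>x. cop_apply P x = y" for y
  proof -
    define f where "f x = x - e *\<^sub>R cop_apply P x + e *\<^sub>R y" for x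
    have "dist (f x) (f x') \<le> sqrt q * dist x x'" for x x'
      using le[of "x - x'"]
      by (simp add: f_def dist_norm cop_apply_diff algebra_simps)
    then have "\<exists>!x. f x = x"
      using q by (intro banach_fix_type[where c = "sqrt q"]) auto
    then obtain x where "f x = x" by blast
    then have "e *\<^sub>R (y - cop_apply P x) = 0"
      by (simp add: f_def algebra_simps)
    then show ?thesis
      using \<open>e > 0\<close> by auto
  qed
  then show ?thesis
    by (metis surj_def)
qed

text \<open>The lower bound does double duty: it gives injectivity, and it bounds the set-theoretic
  inverse by 1/c.\<close>

lemma cop_invertibleI_bounded_below:
  fixes T :: "'a::complex_inner \<Rightarrow>\<^sub>H 'b::complex_inner"
  assumes "c > 0" and below: "\<And>x. c * norm x \<le> norm (cop_apply T x)"
    and surj: "surj (cop_apply T)"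
  shows "cop_invertible T"
proof -
  have inj: "inj (cop_apply T)"
  proof (rule injI)
    fix x y
    assume "cop_apply T x = cop_apply T y"
    then have "c * norm (x - y) \<le> 0"
      using below[of "x - y"] by (simp add: cop_apply_diff)
    then show "x = y"
      using \<open>c > 0\<close> by (simp add: mult_le_0_iff)
  qed
  define g where "g = inv (cop_apply T)"
  have gT: "g (cop_apply T x) = x" for x
    using inj by (simp add: g_def)
  have Tg: "cop_apply T (g y) = y" for y
    using surj by (simp add: g_def surj_f_inv_f)
  have "bounded_linear g"
  proof (rule bounded_linear_intro[where K = "inverse c"])
    show "g (x + y) = g x + g y" for x y
      using gT[of "g x + g y"] by (simp add: cop_apply_add Tg)
    show "g (r *\<^sub>R x) = r *\<^sub>R g x" for r x
      using gT[of "r *\<^sub>R g x"] by (simp add: cop_apply_scaleR Tg)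
    show "norm (g x) \<le> norm x * inverse c" for x
      using below[of "g x"] \<open>c > 0\<close> by (simp add: Tg field_simps)
  qed
  moreover have "g (a *\<^sub>C x) = a *\<^sub>C g x" for a x
    using gT[of "a *\<^sub>C g x"] by (simp add: cop_scaleC Tg)
  ultimately have "bounded_clinear g"
    by (simp add: bounded_clinear_def)
  then have "cop_inverse_of (Cop g) T"
    unfolding cop_inverse_of_def
    by (auto intro!: cop_eqI simp: cop_algebra_apply Cop_inverse gT Tg)
  then show ?thesis
    unfolding cop_invertible_def by blast
qed

text \<open>\<open>T o\<^sub>C T\<^sup>\<star>\<close> is coercive as soon as \<open>T\<^sup>\<star>\<close> is bounded below.\<close>

lemma cop_invertibleI_bounded_below_adj:
  fixes T :: "'a::chilbert_space \<Rightarrow>\<^sub>H 'b::chilbert_space"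
  assumes "c > 0" and below: "\<And>x. c * norm x \<le> norm (cop_apply T x)"
    and below_adj: "\<And>y. c * norm y \<le> norm (cop_apply (T\<^sup>\<star>) y)"
  shows "cop_invertible T"
proof (rule cop_invertibleI_bounded_below[OF \<open>c > 0\<close> below])
  have "surj (cop_apply (T o\<^sub>C T\<^sup>\<star>))"
  proof (rule coercive_imp_surj)
    show "c\<^sup>2 > 0"
      using \<open>c > 0\<close> by simp
    fix y
    have "c\<^sup>2 * (norm y)\<^sup>2 \<le> (norm (cop_apply (T\<^sup>\<star>) y))\<^sup>2"
      using power_mono[OF below_adj[of y], of 2] \<open>c > 0\<close> by (simp add: power_mult_distrib)
    also have "\<dots> = inner (cop_apply (T o\<^sub>C T\<^sup>\<star>) y) y"
      by (simp add: cop_comp.rep_eq cinner_cop_adj power2_norm_eq_inner flip: Re_cinner)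
    finally show "c\<^sup>2 * (norm y)\<^sup>2 \<le> inner (cop_apply (T o\<^sub>C T\<^sup>\<star>) y) y" .
  qed
  then show "surj (cop_apply T)"
    unfolding surj_def cop_comp.rep_eq by metis
qed

text \<open>In place of a Neumann series: the constant 1 - norm X serves both as lower bound
  (reverse triangle inequality) and as coercivity constant (Cauchy-Schwarz).\<close>

lemma cop_invertible_id_minus:
  fixes X :: "'a::chilbert_space \<Rightarrow>\<^sub>H 'a"
  assumes "norm X < 1"
  shows "cop_invertible (cop_id - X)"
proof (rule cop_invertibleI_bounded_below)
  show "1 - norm X > 0"
    using assms by simp
  show "(1 - norm X) * norm x \<le> norm (cop_apply (cop_id - X) x)" for x
    using norm_triangle_ineq2[of x "cop_apply X x"] norm_cop_apply[of X x]
    by (simp add: cop_algebra_apply algebra_simps)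
  have "(1 - norm X) * (norm x)\<^sup>2 \<le> inner (cop_apply (cop_id - X) x) x" for x
  proof -
    have "inner (cop_apply X x) x \<le> norm (cop_apply X x) * norm x"
      by (rule norm_cauchy_schwarz)
    also have "\<dots> \<le> norm X * norm x * norm x"
      by (intro mult_right_mono norm_cop_apply) simp
    finally show ?thesis
      by (simp add: cop_algebra_apply inner_diff_left algebra_simps power2_eq_square
          flip: power2_norm_eq_inner)
  qed
  then show "surj (cop_apply (cop_id - X))"
    using \<open>1 - norm X > 0\<close> by (intro coercive_imp_surj)
qed

section \<open>Resolvents of selfadjoint contractions on the slit plane\<close>

text \<open>A zero t of 1 - z t in [-1, 1] would make z = 1/t real of modulus at least 1, which the
  slit plane excludes. Compactness turns nonvanishing into a uniform bound.\<close>

lemma slit_plane_bounded_below: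
  assumes "z \<in> slit_plane"
  obtains d where "d > 0" and "\<And>t. \<bar>t\<bar> \<le> 1 \<Longrightarrow> d \<le> cmod (1 - z * of_real t)"
proof -
  have "\<exists>s\<in>{-1..1::real}. \<forall>t\<in>{-1..1}. cmod (1 - z * of_real s) \<le> cmod (1 - z * of_real t)"
    by (rule continuous_attains_inf) (auto intro!: continuous_intros)
  then obtain s :: real where s: "\<bar>s\<bar> \<le> 1"
    and min: "\<And>t. \<bar>t\<bar> \<le> 1 \<Longrightarrow> cmod (1 - z * of_real s) \<le> cmod (1 - z * of_real t)"
    unfolding Bex_def Ball_def atLeastAtMost_iff by (metis abs_le_iff minus_le_iff)
  have "1 - z * of_real s \<noteq> 0"
  proof
    assume "1 - z * of_real s = 0"
    then have "s \<noteq> 0" and "z = of_real (1 / s)"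
      by (cases "s = 0"; simp add: eq_divide_eq)+
    moreover have "1 / s \<le> -1 \<or> 1 / s \<ge> 1"
      using s \<open>s \<noteq> 0\<close> by (cases "s > 0") (auto simp: le_divide_eq divide_le_eq)
    ultimately have "z \<in> of_real ` ({..-1} \<union> {1..})"
      by (intro image_eqI[of _ _ "1 / s"]) simp_all
    then show False
      using assms by (simp add: slit_plane_def)
  qed
  then show ?thesis
    using min by (intro that[of "cmod (1 - z * of_real s)"]) auto
qed

text \<open>The numerical range of \<open>I - z F\<close> lies in the segment \<open>{1 - z t | -1 \<le> t \<le> 1}\<close>, which avoids
  the origin.\<close>

lemma resolvent_bounded_below:
  fixes F :: "'a::chilbert_space \<Rightarrow>\<^sub>H 'a"
  assumes F: "selfadjoint F" "contraction F"
    and d: "\<And>t. \<bar>t\<bar> \<le> 1 \<Longrightarrow> d \<le> cmod (1 - z * of_real t)"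
  shows "d * norm x \<le> norm (cop_apply (cop_id - z *\<^sub>C F) x)"
proof (cases "x = 0")
  case False
  \<comment> \<open>The Rayleigh quotient of \<open>F\<close> at \<open>x\<close>. Selfadjointness
    makes the quadratic form real, so its real part determines it.\<close>
  define t where "t = inner (cop_apply F x) x / (norm x)\<^sup>2"
  have "\<bar>inner (cop_apply F x) x\<bar> \<le> norm x * norm x"
    using Cauchy_Schwarz_ineq2[of "cop_apply F x" x]
      mult_right_mono[OF contraction_apply[OF F(2), of x], of "norm x"] by simp
  then have t: "\<bar>t\<bar> \<le> 1"
    using False by (simp add: t_def power2_eq_square abs_mult)
  have "cinner (cop_apply F x) x = cnj (cinner (cop_apply F x) x)"
    using F(1) cinner_commute unfolding selfadjoint_iff by metis
  then have Fx: "cinner (cop_apply F x) x = of_real (t * (norm x)\<^sup>2)"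
    using False by (simp add: t_def complex_eq_iff Re_cinner del: of_real_mult)
  have xx: "cinner x x = of_real ((norm x)\<^sup>2)"
    using cinner_commute[of x x] by (simp add: complex_eq_iff Re_cinner power2_norm_eq_inner)
  have "cinner (cop_apply (cop_id - z *\<^sub>C F) x) x
      = (1 - z * of_real t) * of_real ((norm x)\<^sup>2)"
    \<comment> \<open>Additivity at (x - z F x) + z F x = x acts as the subtraction rule for
      \<open>cinner\<close>.\<close>
    using cinner_add_left[of "x - z *\<^sub>C cop_apply F x" "z *\<^sub>C cop_apply F x" x]
    by (simp add: cop_algebra_apply cinner_scaleC_left Fx xx algebra_simps)
  then have "cmod (1 - z * of_real t) * (norm x)\<^sup>2 \<le> norm (cop_apply (cop_id - z *\<^sub>C F) x) * norm x"
    using cmod_cinner_le[of "cop_apply (cop_id - z *\<^sub>C F) x" x] by (simp add: norm_mult norm_power)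
  then have "cmod (1 - z * of_real t) * norm x \<le> norm (cop_apply (cop_id - z *\<^sub>C F) x)"
    using False by (simp add: power2_eq_square flip: mult.assoc)
  then show ?thesis
    using mult_right_mono[OF d[OF t], of "norm x"] by simp
qed simp

text \<open>The adjoint of I - z F is I - cnj z F. Conjugation preserves moduli, so one constant
  \<open>d\<close> bounds both operators from below.\<close>

lemma resolvent_invertible:
  fixes F :: "'a::chilbert_space \<Rightarrow>\<^sub>H 'a"
  assumes F: "selfadjoint F" "contraction F" and z: "z \<in> slit_plane"
  shows "cop_invertible (cop_id - z *\<^sub>C F)"
proof -
  obtain d where d: "d > 0" "\<And>t. \<bar>t\<bar> \<le> 1 \<Longrightarrow> d \<le> cmod (1 - z * of_real t)"
    using slit_plane_bounded_below[OF z] by blast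
  have d': "d \<le> cmod (1 - cnj z * of_real t)" if "\<bar>t\<bar> \<le> 1" for t
  proof -
    have "cmod (1 - cnj z * of_real t) = cmod (cnj (1 - z * of_real t))"
      by simp
    then show ?thesis
      using d(2)[OF that] by (simp only: complex_mod_cnj)
  qed
  have "(cop_id - z *\<^sub>C F)\<^sup>\<star> = cop_id - cnj z *\<^sub>C F"
  proof (rule cop_adj_eqI)
    fix x y
    have "cinner (cop_apply F x) y = cinner x (cop_apply F y)"
      using F(1) unfolding selfadjoint_iff by blast
    then show "cinner (cop_apply (cop_id - z *\<^sub>C F) x) y = cinner x (cop_apply (cop_id - cnj z *\<^sub>C F) y)"
      using cinner_add_left[of "x - z *\<^sub>C cop_apply F x" "z *\<^sub>C cop_apply F x" y]
        cinner_add_right[of x "y - cnj z *\<^sub>C cop_apply F y" "cnj z *\<^sub>C cop_apply F y"]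
      by (simp add: cop_algebra_apply cinner_scaleC_left cinner_scaleC_right)
  qed
  then show ?thesis
    using resolvent_bounded_below[OF F d(2)] resolvent_bounded_below[OF F d']
    by (intro cop_invertibleI_bounded_below_adj[OF d(1)]) auto
qed

section \<open>Feedback connections\<close>

lemma
  assumes "cop_invertible T"
  shows cop_inv_left: "cop_apply (cop_inv T) (cop_apply T x) = x"
    and cop_inv_right: "cop_apply T (cop_apply (cop_inv T) y) = y"
proof -
  have "cop_inv T o\<^sub>C T = cop_id" "T o\<^sub>C cop_inv T = cop_id"
    using cop_inverse_of_cop_inv[OF assms] by (simp_all add: cop_inverse_of_def)
  then have "cop_apply (cop_inv T o\<^sub>C T) x = x" "cop_apply (T o\<^sub>C cop_inv T) y = y"
    by (simp_all add: cop_id.rep_eq)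
  then show "cop_apply (cop_inv T) (cop_apply T x) = x" "cop_apply T (cop_apply (cop_inv T) y) = y"
    by (simp_all add: cop_comp.rep_eq)
qed

text \<open>Inverses of I - X are used below only as solution operators of y = x + X y. This rule
  gives existence of the solution, the next one uniqueness.\<close>

lemma cop_inv_id_minus_fix:
  assumes "cop_invertible (cop_id - X)"
  shows "cop_apply (cop_inv (cop_id - X)) x = x + cop_apply X (cop_apply (cop_inv (cop_id - X)) x)"
  using cop_inv_right[OF assms, of x]
  unfolding minus_cop.rep_eq cop_id.rep_eq diff_eq_eq .

lemma cop_inv_id_minus_eqI:
  assumes "cop_invertible (cop_id - X)" and "y = x + cop_apply X y"
  shows "cop_apply (cop_inv (cop_id - X)) x = y"
proof -
  have "cop_apply (cop_id - X) y = x"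
    \<comment> \<open>Only the first \<open>y\<close> is rewritten, so that the two terms X y
      cancel.\<close>
    unfolding minus_cop.rep_eq cop_id.rep_eq by (subst (1) assms(2)) simp
  then show ?thesis
    using cop_inv_left[OF assms(1), of y] by simp
qed

text \<open>Applying X to the fixed-point equation of Y X yields that of X Y.\<close>

lemma cop_inv_push_through:
  assumes "cop_invertible (cop_id - X o\<^sub>C Y)" and "cop_invertible (cop_id - Y o\<^sub>C X)"
  shows "cop_apply (cop_inv (cop_id - X o\<^sub>C Y)) (cop_apply X v)
    = cop_apply X (cop_apply (cop_inv (cop_id - Y o\<^sub>C X)) v)"
  using arg_cong[OF cop_inv_id_minus_fix[OF assms(2), of v], of "cop_apply X"]
  by (intro cop_inv_id_minus_eqI[OF assms(1)]) (simp only: cop_apply_add cop_comp.rep_eq)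

lemma cinner_zero [simp]: "cinner 0 y = 0" "cinner x 0 = 0"
  for x y :: "'a::complex_inner"
  using cinner_add_left[of 0 0 y] cinner_add_right[of x 0 0] by simp_all

section \<open>Block entries of selfadjoint contractions\<close>

lemma selfadjoint_block21:
  assumes "selfadjoint T"
  shows "block21 T = (block12 T)\<^sup>\<star>"
proof (rule cop_adj_eqI[symmetric])
  fix x y
  show "cinner (cop_apply (block12 T) x) y = cinner x (cop_apply (block21 T) y)"
    using assms[unfolded selfadjoint_iff, rule_format, of "(0, x)" "(y, 0)"]
    by (cases "cop_apply T (0, x)"; cases "cop_apply T (y, 0)") (simp add: block_entry_apply)
qed

lemma selfadjoint_block22:
  assumes "selfadjoint T"
  shows "selfadjoint (block22 T)"
  unfolding selfadjoint_iff
proof (intro allI)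
  fix x y
  show "cinner (cop_apply (block22 T) x) y = cinner x (cop_apply (block22 T) y)"
    using assms[unfolded selfadjoint_iff, rule_format, of "(0, x)" "(0, y)"]
    by (cases "cop_apply T (0, x)"; cases "cop_apply T (0, y)") (simp add: block_entry_apply)
qed

lemma contraction_block11: "contraction T \<Longrightarrow> contraction (block11 T)"
proof (rule contractionI)
  fix x
  assume "contraction T"
  then have "norm (cop_apply T (x, 0)) \<le> norm x"
    using contraction_apply[of T "(x, 0)"] by (simp add: norm_Pair)
  then show "norm (cop_apply (block11 T) x) \<le> norm x"
    by (cases "cop_apply T (x, 0)") (use norm_fst_le in \<open>auto simp: block_entry_apply intro: order_trans\<close>)
qed

lemma contraction_block22: "contraction T \<Longrightarrow> contraction (block22 T)"
proof (rule contractionI)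
  fix x
  assume "contraction T"
  then have "norm (cop_apply T (0, x)) \<le> norm x"
    using contraction_apply[of T "(0, x)"] by (simp add: norm_Pair)
  then show "norm (cop_apply (block22 T) x) \<le> norm x"
    by (cases "cop_apply T (0, x)") (use norm_snd_le in \<open>auto simp: block_entry_apply intro: order_trans\<close>)
qed

lemma selfadjoint_apply:
  assumes "selfadjoint T"
  shows "cop_apply T (x, y) = (cop_apply (block11 T) x + cop_apply (block12 T) y,
    cop_apply ((block12 T)\<^sup>\<star>) x + cop_apply (block22 T) y)"
  using block_apply[of "block11 T" "block12 T" "block21 T" "block22 T" x y]
  by (simp only: block_collapse flip: selfadjoint_block21[OF assms])

text \<open>Compression to the state space preserves selfadjointness and contractivity, so the
  resolvent result applies to the lower right entry.\<close>

lemma transfer_defined_passive: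
  assumes "passive_selfadjoint_system T" and "z \<in> slit_plane"
  shows "transfer_defined T z"
  using assms unfolding passive_selfadjoint_system_def transfer_defined_def
  by (auto intro: resolvent_invertible selfadjoint_block22 contraction_block22)

section \<open>The Redheffer product as a closed loop\<close>

text \<open>Replaces the explicit entries of the product by two relations with internal signals
  \<open>u\<close> and \<open>y\<close>; passivity and the transfer function identity are derived
  from these.\<close>

lemma redheffer_feedback:
  assumes "selfadjoint K" "selfadjoint S" "redheffer_defined K S"
  obtains u y where "cop_apply K (m, y) = (fst (cop_apply (redheffer K S) (m, k)), u)"
    and "cop_apply S (u, k) = (y, snd (cop_apply (redheffer K S) (m, k)))"
proof -
  define R where "R = cop_inv (cop_id - block22 K o\<^sub>C block11 S)"
  define L where "L = cop_inv (cop_id - block11 S o\<^sub>C block22 K)"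
  note inv = assms(3)[unfolded redheffer_defined_def]
  \<comment> \<open>\<open>n\<close> and \<open>b\<close> are the external inputs to the loop u = n
    + K22 y, y = A u + b. Eliminating \<open>y\<close> leaves (I - K22 A) u = n + K22 b, which
    \<open>R\<close> solves.\<close>
  define b where "b = cop_apply (block12 S) k"
  define n where "n = cop_apply ((block12 K)\<^sup>\<star>) m"
  define u where "u = cop_apply R (n + cop_apply (block22 K) b)"
  define y where "y = cop_apply (block11 S) u + b"
  have R_push: "cop_apply R (cop_apply (block22 K) b) = cop_apply (block22 K) (cop_apply L b)"
    unfolding R_def L_def using inv by (intro cop_inv_push_through) auto
  have L_fix: "cop_apply L b = b + cop_apply (block11 S) (cop_apply (block22 K) (cop_apply L b))"
    using cop_inv_id_minus_fix[OF inv[THEN conjunct2], of b] unfolding L_def cop_comp.rep_eq .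
  have u: "u = n + cop_apply (block22 K) y"
    using inv cop_inv_id_minus_fix[of "block22 K o\<^sub>C block11 S" "n + cop_apply (block22 K) b"]
    by (simp add: cop_comp.rep_eq y_def cop_apply_add[of "block22 K"] ac_simps flip: u_def R_def)
  \<comment> \<open>Puts \<open>y\<close> in the form in which the entries of the product contain
    it, one inverse for each external input.\<close>
  have y: "y = cop_apply (block11 S) (cop_apply R n) + cop_apply L b"
    by (subst L_fix) (simp add: y_def u_def cop_apply_add R_push)
  have T: "cop_apply (redheffer K S) (m, k) =
      (cop_apply (block11 K) m + cop_apply (block12 K) y,
       cop_apply ((block12 S)\<^sup>\<star>) u + cop_apply (block22 S) k)"
    unfolding y u_def
    by (simp add: redheffer_def Let_def block_apply cop_algebra_apply cop_apply_add R_push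
        flip: R_def L_def b_def n_def)
  show ?thesis
  proof
    show "cop_apply K (m, y) = (fst (cop_apply (redheffer K S) (m, k)), u)"
      by (simp add: T selfadjoint_apply[OF assms(1)] u n_def)
    show "cop_apply S (u, k) = (y, snd (cop_apply (redheffer K S) (m, k)))"
      by (simp add: T selfadjoint_apply[OF assms(2)] y_def b_def)
  qed
qed

lemma passive_redheffer:
  assumes K: "passive_selfadjoint_system K" and S: "passive_selfadjoint_system S"
    and "redheffer_defined K S"
  shows "passive_selfadjoint_system (redheffer K S)"
proof -
  have sa: "selfadjoint K" "selfadjoint S" and contr: "contraction K" "contraction S"
    using K S by (simp_all add: passive_selfadjoint_system_def)
  note feedback = redheffer_feedback[OF sa assms(3)]
  let ?T = "cop_apply (redheffer K S)"
  have "cinner (?T p) q = cinner p (?T q)" for p q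
  proof -
    obtain m k n l where pq: "p = (m, k)" "q = (n, l)" by (meson surj_pair)
    obtain u y where p: "cop_apply K (m, y) = (fst (?T p), u)" "cop_apply S (u, k) = (y, snd (?T p))"
      by (rule feedback[of m k, folded pq])
    obtain w v where q: "cop_apply K (n, v) = (fst (?T q), w)" "cop_apply S (w, l) = (v, snd (?T q))"
      by (rule feedback[of n l, folded pq])
    \<comment> \<open>The internal pairings of \<open>u\<close> with \<open>v\<close> and of
      \<open>y\<close> with \<open>w\<close> stand on opposite sides in the two symmetry
      relations.\<close>
    have "cinner (fst (?T p)) n + cinner u v = cinner m (fst (?T q)) + cinner y w"
      using sa(1)[unfolded selfadjoint_iff, rule_format, of "(m, y)" "(n, v)"] by (simp add: p q)
    moreover have "cinner y w + cinner (snd (?T p)) l = cinner u v + cinner k (snd (?T q))"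
      using sa(2)[unfolded selfadjoint_iff, rule_format, of "(u, k)" "(w, l)"] by (simp add: p q)
    ultimately have "cinner (fst (?T p)) n + cinner (snd (?T p)) l
        = cinner m (fst (?T q)) + cinner k (snd (?T q))"
      by algebra
    then show ?thesis
      by (simp add: cinner_prod_def pq)
  qed
  moreover have "norm (?T p) \<le> norm p" for p
  proof -
    obtain m k where p: "p = (m, k)" by (meson surj_pair)
    obtain u y where uy: "cop_apply K (m, y) = (fst (?T p), u)" "cop_apply S (u, k) = (y, snd (?T p))"
      by (rule feedback[of m k, folded p])
    have "(norm (fst (?T p)))\<^sup>2 + (norm u)\<^sup>2 \<le> (norm m)\<^sup>2 + (norm y)\<^sup>2"
      using contraction_apply[OF contr(1), of "(m, y)"] by (simp add: uy norm_Pair)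
    moreover have "(norm y)\<^sup>2 + (norm (snd (?T p)))\<^sup>2 \<le> (norm u)\<^sup>2 + (norm k)\<^sup>2"
      using contraction_apply[OF contr(2), of "(u, k)"] by (simp add: uy norm_Pair)
    ultimately have "(norm (fst (?T p)))\<^sup>2 + (norm (snd (?T p)))\<^sup>2 \<le> (norm m)\<^sup>2 + (norm k)\<^sup>2"
      by linarith
    then show ?thesis
      unfolding p norm_prod_def by simp
  qed
  ultimately show ?thesis
    unfolding passive_selfadjoint_system_def selfadjoint_iff by (blast intro: contractionI)
qed

section \<open>Transfer functions of the closed loop\<close>

text \<open>The state equation has only one solution, so any \<open>x\<close> satisfying it can
  stand for the resolvent term.\<close>

lemma transfer_function_apply:
  assumes "transfer_defined T z" and "x = cop_apply ((block12 T)\<^sup>\<star>) m + z *\<^sub>C cop_apply (block22 T) x"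
  shows "cop_apply (transfer_function T z) m =
    cop_apply (block11 T) m + z *\<^sub>C cop_apply (block12 T) x"
proof -
  have "cop_apply (cop_inv (cop_id - z *\<^sub>C block22 T)) (cop_apply ((block12 T)\<^sup>\<star>) m) = x"
    using assms by (intro cop_inv_id_minus_eqI) (auto simp: transfer_defined_def cop_algebra_apply)
  then show ?thesis
    by (simp add: transfer_function_def Let_def cop_algebra_apply)
qed

lemma transfer_state:
  assumes "transfer_defined T z"
  obtains x where "x = cop_apply ((block12 T)\<^sup>\<star>) m + z *\<^sub>C cop_apply (block22 T) x"
  using cop_inv_id_minus_fix[OF assms[unfolded transfer_defined_def]]
  by (metis scaleC_cop.rep_eq)

text \<open>The inverse is written down explicitly from those of I - K22 A and I - z F. No smallness
  of K22 enters, so the case A = 0 is covered too.\<close>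

lemma feedback_invertible:
  assumes def: "redheffer_defined K S" and S: "transfer_defined S z"
    and T: "transfer_defined (redheffer K S) z"
  shows "cop_invertible (cop_id - block22 K o\<^sub>C transfer_function S z)"
proof -
  let ?A = "cop_apply (block11 S)" and ?B = "cop_apply (block12 S)" and ?G = "cop_apply (block22 S)"
    and ?B' = "cop_apply ((block12 S)\<^sup>\<star>)" and ?K = "cop_apply (block22 K)"
  let ?F = "block22 (redheffer K S)" and ?\<Omega> = "transfer_function S z"
  define R where "R = cop_inv (cop_id - block22 K o\<^sub>C block11 S)"
  define N where "N = cop_inv (cop_id - z *\<^sub>C ?F)"
  note inv = def[unfolded redheffer_defined_def]
  \<comment> \<open>Push-through leaves the inverse \<open>R\<close> as the only one in the state
    operator.\<close>
  have F: "cop_apply ?F x = ?G x + ?B' (cop_apply R (?K (?B x)))" for x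
    using inv by (simp add: redheffer_def Let_def cop_algebra_apply R_def cop_inv_push_through)
  \<comment> \<open>The upper left entry of the inverse of the block operator with rows I - K22 A,
    -z K22 B and -B', I - z G, where B' is the adjoint of B; \<open>N\<close> inverts the Schur
    complement of I - K22 A.\<close>
  define X where "X = R + z *\<^sub>C (R o\<^sub>C block22 K o\<^sub>C block12 S o\<^sub>C N o\<^sub>C (block12 S)\<^sup>\<star> o\<^sub>C R)"
  let ?M = "cop_id - block22 K o\<^sub>C ?\<Omega>"
  have right: "cop_apply ?M (cop_apply X w) = w" for w
  proof -
    \<comment> \<open>The pair \<open>u\<close>, \<open>x\<close> solves the block equation with
      right-hand side (w, 0); its second row makes \<open>x\<close> the state of \<open>S\<close>
      under input \<open>u\<close>.\<close>
    define x where "x = cop_apply N (?B' (cop_apply R w))"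
    define u where "u = cop_apply R (w + z *\<^sub>C ?K (?B x))"
    have u: "cop_apply X w = u"
      by (simp add: X_def u_def x_def cop_algebra_apply cop_apply_add cop_scaleC)
    have u_fix: "u = w + z *\<^sub>C ?K (?B x) + ?K (?A u)"
      unfolding u_def R_def
      using cop_inv_id_minus_fix[OF inv[THEN conjunct1], of "w + z *\<^sub>C ?K (?B x)"]
      by (simp add: cop_comp.rep_eq)
    have "x = ?B' (cop_apply R w) + z *\<^sub>C cop_apply ?F x"
      unfolding x_def N_def
      using cop_inv_id_minus_fix[OF T[unfolded transfer_defined_def], of "?B' (cop_apply R w)"]
      by (simp add: scaleC_cop.rep_eq)
    then have "x = ?B' u + z *\<^sub>C ?G x"
      by (simp add: F u_def cop_apply_add cop_scaleC scaleC_add_right algebra_simps)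
    then have "cop_apply ?\<Omega> u = ?A u + z *\<^sub>C ?B x"
      by (rule transfer_function_apply[OF S])
    then show ?thesis
      using u_fix by (simp add: u cop_algebra_apply cop_apply_add cop_scaleC algebra_simps)
  qed
  \<comment> \<open>A kernel vector and its state solve the homogeneous block equation; eliminating
    \<open>u\<close> leaves (I - z F) x = 0.\<close>
  have inj: "u = 0" if "cop_apply ?M u = 0" for u
  proof -
    obtain x where x: "x = ?B' u + z *\<^sub>C ?G x"
      using transfer_state[OF S] by blast
    then have "u = z *\<^sub>C ?K (?B x) + ?K (?A u)"
      using that transfer_function_apply[OF S x]
      by (simp add: cop_algebra_apply cop_apply_add cop_scaleC algebra_simps)
    then have u: "u = z *\<^sub>C cop_apply R (?K (?B x))"
      unfolding R_def
      using cop_inv_id_minus_eqI[OF inv[THEN conjunct1], of u "z *\<^sub>C ?K (?B x)"]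
      by (simp add: cop_comp.rep_eq cop_scaleC)
    have "x = 0 + cop_apply (z *\<^sub>C ?F) x"
      using x u by (simp add: F scaleC_cop.rep_eq scaleC_add_right cop_scaleC) (metis add.commute cop_scaleC)
    then have "x = 0"
      using cop_inv_id_minus_eqI[OF T[unfolded transfer_defined_def], of x 0] by simp
    then show "u = 0"
      using u by simp
  qed
  \<comment> \<open>By the right inverse property, \<open>?M\<close> sends the difference of both
    sides to 0, so injectivity makes \<open>X\<close> a left inverse as well.\<close>
  have "cop_apply X (cop_apply ?M u) = u" for u
    using inj[of "cop_apply X (cop_apply ?M u) - u"] by (simp add: cop_apply_diff right)
  then have "cop_inverse_of X ?M"
    unfolding cop_inverse_of_def using right
    by (auto intro!: cop_eqI simp: cop_comp.rep_eq cop_id.rep_eq)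
  then show ?thesis
    unfolding cop_invertible_def by blast
qed

lemma transfer_function_redheffer:
  assumes "selfadjoint K" "selfadjoint S" and T_sa: "selfadjoint (redheffer K S)"
    and def: "redheffer_defined K S" and S: "transfer_defined S z"
    and T: "transfer_defined (redheffer K S) z"
  shows "transfer_function (redheffer K S) z = block11 K + block12 K o\<^sub>C transfer_function S z o\<^sub>C
    cop_inv (cop_id - block22 K o\<^sub>C transfer_function S z) o\<^sub>C (block12 K)\<^sup>\<star>"
proof (rule cop_eqI)
  fix m
  let ?\<Omega> = "transfer_function S z"
  obtain x where x: "x = cop_apply ((block12 (redheffer K S))\<^sup>\<star>) m + z *\<^sub>C cop_apply (block22 (redheffer K S)) x"
    using transfer_state[OF T] by blast
  \<comment> \<open>The second component is the state equation, which returns \<open>x\<close>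
    itself.\<close>
  have Tx: "cop_apply (redheffer K S) (m, z *\<^sub>C x) = (cop_apply (transfer_function (redheffer K S) z) m, x)"
    unfolding transfer_function_apply[OF T x] selfadjoint_apply[OF T_sa] cop_scaleC
    by (simp flip: x)
  obtain u y where
      Ky: "cop_apply K (m, y) = (cop_apply (transfer_function (redheffer K S) z) m, u)"
    and Su: "cop_apply S (u, z *\<^sub>C x) = (y, x)"
    by (rule redheffer_feedback[OF assms(1,2) def, of m "z *\<^sub>C x", unfolded Tx fst_conv snd_conv])
  \<comment> \<open>The second component of \<open>Su\<close> shows that \<open>x\<close> is also
    the state of \<open>S\<close> under input \<open>u\<close>; the first is the corresponding
    output.\<close>
  have "cop_apply ?\<Omega> u = y"
    using Su transfer_function_apply[OF S, of x u]
    by (simp add: selfadjoint_apply[OF assms(2)] cop_scaleC)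
  \<comment> \<open>The second row of \<open>Ky\<close> now reads u = n + K22 \<Omega> u, with n the
    image of m under the adjoint of K12.\<close>
  then have "cop_apply (cop_inv (cop_id - block22 K o\<^sub>C ?\<Omega>)) (cop_apply ((block12 K)\<^sup>\<star>) m) = u"
    using Ky by (intro cop_inv_id_minus_eqI feedback_invertible[OF def S T])
      (simp add: selfadjoint_apply[OF assms(1)] cop_comp.rep_eq)
  then show "cop_apply (transfer_function (redheffer K S) z) m = cop_apply (block11 K + block12 K o\<^sub>C ?\<Omega> o\<^sub>C
      cop_inv (cop_id - block22 K o\<^sub>C ?\<Omega>) o\<^sub>C (block12 K)\<^sup>\<star>) m"
    using Ky \<open>cop_apply ?\<Omega> u = y\<close>
    by (simp add: selfadjoint_apply[OF assms(1)] cop_algebra_apply)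
qed

theorem theorem6p9:
  fixes K11 :: "'m::chilbert_space \<Rightarrow>\<^sub>H 'm"
    and K12 :: "'h::chilbert_space \<Rightarrow>\<^sub>H 'm"
    and K22 :: "'h \<Rightarrow>\<^sub>H 'h"
    and A :: "'h \<Rightarrow>\<^sub>H 'h"
    and B :: "'k::chilbert_space \<Rightarrow>\<^sub>H 'h"
    and G :: "'k \<Rightarrow>\<^sub>H 'k"
    and S :: "'h \<times> 'k \<Rightarrow>\<^sub>H 'h \<times> 'k"
    and K :: "'m \<times> 'h \<Rightarrow>\<^sub>H 'm \<times> 'h"
    and \<Omega> :: "complex \<Rightarrow> 'h \<Rightarrow>\<^sub>H 'h"
    and \<Theta> :: "complex \<Rightarrow> 'm \<Rightarrow>\<^sub>H 'm"
  assumes S_def: "S = block A B (B\<^sup>\<star>) G"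
    and K_def: "K = block K11 K12 (K12\<^sup>\<star>) K22"
    and S: "passive_selfadjoint_system S"
    and K: "selfadjoint K" "contraction K"
    and \<Omega>: "\<And>z. z \<in> slit_plane \<Longrightarrow> \<Omega> z = transfer_function S z"
    and \<Theta>: "\<And>z. z \<in> slit_plane \<Longrightarrow>
      \<Theta> z = K11 + K12 o\<^sub>C \<Omega> z o\<^sub>C cop_inv (cop_id - K22 o\<^sub>C \<Omega> z) o\<^sub>C K12\<^sup>\<star>"
  shows
    "(norm K22 < 1 \<longrightarrow>
        redheffer_defined K S \<and>
        redheffer K S = block
          (K11 + K12 o\<^sub>C A o\<^sub>C cop_inv (cop_id - K22 o\<^sub>C A) o\<^sub>C K12\<^sup>\<star>)
          (K12 o\<^sub>C cop_inv (cop_id - A o\<^sub>C K22) o\<^sub>C B)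
          (B\<^sup>\<star> o\<^sub>C cop_inv (cop_id - K22 o\<^sub>C A) o\<^sub>C K12\<^sup>\<star>)
          (G + B\<^sup>\<star> o\<^sub>C K22 o\<^sub>C cop_inv (cop_id - A o\<^sub>C K22) o\<^sub>C B) \<and>
        passive_selfadjoint_system (redheffer K S) \<and>
        (\<forall>z\<in>slit_plane.
          transfer_defined S z \<and> cop_invertible (cop_id - K22 o\<^sub>C \<Omega> z) \<and>
          transfer_defined (redheffer K S) z \<and> \<Theta> z = transfer_function (redheffer K S) z)) \<and>
     (A = 0 \<longrightarrow>
        redheffer_defined K S \<and>
        redheffer K S = block
          K11          (K12 o\<^sub>C B)
          (B\<^sup>\<star> o\<^sub>C K12\<^sup>\<star>)  (G + B\<^sup>\<star> o\<^sub>C K22 o\<^sub>C B) \<and>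
        passive_selfadjoint_system (redheffer K S) \<and>
        (\<forall>z\<in>slit_plane.
          transfer_defined S z \<and> cop_invertible (cop_id - K22 o\<^sub>C \<Omega> z) \<and>
          transfer_defined (redheffer K S) z \<and> \<Theta> z = transfer_function (redheffer K S) z))"
proof -
  have entries: "block11 K = K11" "block12 K = K12" "block22 K = K22"
    "block11 S = A" "block12 S = B" "block22 S = G"
    by (simp_all add: K_def S_def)
  have K_passive: "passive_selfadjoint_system K"
    using K by (simp add: passive_selfadjoint_system_def)
  have S_sa: "selfadjoint S" and "contraction S"
    using S by (simp_all add: passive_selfadjoint_system_def)
  \<comment> \<open>Shared by both parts, which differ only in why the loop inverses exist and in
    the displayed form of the product.\<close>
  have main: "passive_selfadjoint_system (redheffer K S) \<and>
      (\<forall>z\<in>slit_plane.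
        transfer_defined S z \<and> cop_invertible (cop_id - K22 o\<^sub>C \<Omega> z) \<and>
        transfer_defined (redheffer K S) z \<and> \<Theta> z = transfer_function (redheffer K S) z)"
    if def: "redheffer_defined K S"
  proof -
    have T: "passive_selfadjoint_system (redheffer K S)"
      by (rule passive_redheffer[OF K_passive S def])
    then have T_sa: "selfadjoint (redheffer K S)"
      by (simp add: passive_selfadjoint_system_def)
    show ?thesis
      using T transfer_defined_passive[OF S] transfer_defined_passive[OF T]
        feedback_invertible[OF def] transfer_function_redheffer[OF K(1) S_sa T_sa def]
      by (simp add: \<Omega> \<Theta> entries)
  qed
  \<comment> \<open>As a corner of a contraction, \<open>A\<close> has norm at most 1, so both loop
    products have norm below 1.\<close>
  have "redheffer_defined K S" if "norm K22 < 1"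
  proof -
    have "norm A \<le> 1"
      using contraction_block11[OF \<open>contraction S\<close>] by (simp add: contraction_def entries)
    then have "norm K22 * norm A < 1" "norm A * norm K22 < 1"
      using that mult_left_mono[of "norm A" 1 "norm K22"] by (simp_all add: mult.commute)
    then show ?thesis
      unfolding redheffer_defined_def entries
      using norm_cop_comp_le[of K22 A] norm_cop_comp_le[of A K22]
      by (auto intro!: cop_invertible_id_minus)
  qed
  moreover have "redheffer_defined K S \<and>
      redheffer K S = block K11 (K12 o\<^sub>C B) (B\<^sup>\<star> o\<^sub>C K12\<^sup>\<star>) (G + B\<^sup>\<star> o\<^sub>C K22 o\<^sub>C B)" if "A = 0"
  proof -
    \<comment> \<open>For A = 0 both operators to be inverted are the identity.\<close>
    have id: "cop_inverse_of cop_id (cop_id :: 'h \<Rightarrow>\<^sub>H 'h)"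
      by (simp add: cop_inverse_of_def)
    show ?thesis
      using id by (auto simp: redheffer_defined_def redheffer_def entries that cop_invertible_def
          cop_inv_eqI[OF id])
  qed
  moreover have "redheffer K S = block
      (K11 + K12 o\<^sub>C A o\<^sub>C cop_inv (cop_id - K22 o\<^sub>C A) o\<^sub>C K12\<^sup>\<star>)
      (K12 o\<^sub>C cop_inv (cop_id - A o\<^sub>C K22) o\<^sub>C B)
      (B\<^sup>\<star> o\<^sub>C cop_inv (cop_id - K22 o\<^sub>C A) o\<^sub>C K12\<^sup>\<star>)
      (G + B\<^sup>\<star> o\<^sub>C K22 o\<^sub>C cop_inv (cop_id - A o\<^sub>C K22) o\<^sub>C B)"
    by (simp add: redheffer_def entries)
  ultimately show ?thesis
    using main by blast
qed

end
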